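(* Let $R$ be a commutative ring with unity and let $M$ be an $R$-module with $\operatorname{Spec}(M)\neq\emptyset$. Then $B=\{\widetilde{D}(S) \mid S \text{ is a multiplicatively closed subset of } R\}$ is a basis for the topological space $\widetilde{\operatorname{Spec}(M)}$.
   Context: For a submodule $N$ of an $R$-module $M$, $(N:M)=\{r\in R : rM\subseteq N\}$. A proper submodule $P$ of $M$ is prime if whenever $rm\in P$ with $r\in R$, $m\in M$, then $m\in P$ or $r\in(P:M)$; in this case $(P:M)$ is a prime ideal of $R$. $\operatorname{Spec}(M)$ is the set of all prime submodules of $M$. A subset $T\subseteq R$ is multiplicatively closed if $1\in T$ and $xy\in T$ whenever $x,y\in T$. For a family $\mathcal{S}=\{S_i\}_{i\in I}$ of multiplicatively closed subsets of $R$, $\widetilde{V}(\mathcal{S})=\{P\in\operatorname{Spec}(M) \mid (P:M)\cap S_i\neq\emptyset \text{ for all } i\in I\}$. $\widetilde{\operatorname{Spec}(M)}$ denotes the set $\operatorname{Spec}(M)$ with the topology whose closed sets are exactly the sets $\widetilde{V}(\mathcal{S})$, $\mathcal{S}$ ranging over all families of multiplicatively closed subsets of $R$. For a multiplicatively closed subset $T$ of $R$, $\widetilde{D}(T)=\{P\in\operatorname{Spec}(M) \mid (P:M)\cap T=\emptyset\}$. *)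

theory Defs
  imports "HOL-Analysis.Analysis" "HOL-Algebra.Module"
begin

definition colon :: "('r, 'a) ring_scheme \<Rightarrow> ('r, 'm, 'b) module_scheme \<Rightarrow> 'm set \<Rightarrow> 'r set"
  where "colon R M N = {r \<in> carrier R. \<forall>m \<in> carrier M. r \<odot>\<^bsub>M\<^esub> m \<in> N}"

definition prime_submodule :: "'m set \<Rightarrow> ('r, 'a) ring_scheme \<Rightarrow> ('r, 'm, 'b) module_scheme \<Rightarrow> bool"
  where "prime_submodule P R M \<longleftrightarrow>
    submodule P R M \<and> P \<noteq> carrier M \<and>
    (\<forall>r \<in> carrier R. \<forall>m \<in> carrier M. r \<odot>\<^bsub>M\<^esub> m \<in> P \<longrightarrow> m \<in> P \<or> r \<in> colon R M P)"

definition mod_Spec :: "('r, 'a) ring_scheme \<Rightarrow> ('r, 'm, 'b) module_scheme \<Rightarrow> 'm set set"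
  where "mod_Spec R M = {P. prime_submodule P R M}"

text \<open>The library's \<^term>\<open>submonoid S R\<close> refers to the multiplicative monoid of the ring \<open>R\<close>,
  so it says precisely that \<open>S\<close> is a multiplicatively closed subset of \<open>R\<close> (containing \<open>\<one>\<close>,
  possibly containing \<open>\<zero>\<close>).
  A family of such sets is represented by the set of its members, on which alone
  \<open>V_tilde\<close> depends; the empty family is allowed.\<close>

definition V_tilde :: "('r, 'a) ring_scheme \<Rightarrow> ('r, 'm, 'b) module_scheme \<Rightarrow> 'r set set \<Rightarrow> 'm set set"
  where "V_tilde R M \<S> = {P \<in> mod_Spec R M. \<forall>S \<in> \<S>. colon R M P \<inter> S \<noteq> {}}"

definition D_tilde :: "('r, 'a) ring_scheme \<Rightarrow> ('r, 'm, 'b) module_scheme \<Rightarrow> 'r set \<Rightarrow> 'm set set"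
  where "D_tilde R M T = {P \<in> mod_Spec R M. colon R M P \<inter> T = {}}"

definition Spec_tilde :: "('r, 'a) ring_scheme \<Rightarrow> ('r, 'm, 'b) module_scheme \<Rightarrow> 'm set topology"
  where "Spec_tilde R M =
    topology (\<lambda>U. U \<subseteq> mod_Spec R M \<and>
      (\<exists>\<S>. (\<forall>S \<in> \<S>. submonoid S R) \<and> mod_Spec R M - U = V_tilde R M \<S>))"

text \<open>The counterpart of \<^const>\<open>topological_basis\<close> for the type \<^typ>\<open>'a topology\<close>.\<close>

definition basis_of :: "'a topology \<Rightarrow> 'a set set \<Rightarrow> bool"
  where "basis_of X \<B> \<longleftrightarrow>
    (\<forall>B \<in> \<B>. openin X B) \<and> (\<forall>U. openin X U \<longrightarrow> (\<exists>\<B>'. \<B>' \<subseteq> \<B> \<and> \<Union>\<B>' = U))"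

text \<open>The predicate in the definition of \<open>Spec_tilde\<close> is indeed a topology, with underlying set
  \<open>mod_Spec R M\<close> and with the sets \<open>V_tilde R M \<S>\<close> as its closed sets.\<close>

lemma colon_mult_iff:
  assumes M: "Module.module R M" and P: "prime_submodule P R M"
    and x: "x \<in> carrier R" and y: "y \<in> carrier R"
  shows "x \<otimes>\<^bsub>R\<^esub> y \<in> colon R M P \<longleftrightarrow> x \<in> colon R M P \<or> y \<in> colon R M P"
proof -
  interpret M: Module.module R M by (rule M)
  interpret P: submodule P R M using P by (simp add: prime_submodule_def)
  have comm: "x \<otimes>\<^bsub>R\<^esub> y = y \<otimes>\<^bsub>R\<^esub> x" using x y by (rule M.R.m_comm)
  show ?thesis
  proof
    assume a: "x \<otimes>\<^bsub>R\<^esub> y \<in> colon R M P"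
    show "x \<in> colon R M P \<or> y \<in> colon R M P"
    proof (rule disjCI)
      assume "y \<notin> colon R M P"
      then obtain m where m: "m \<in> carrier M" "y \<odot>\<^bsub>M\<^esub> m \<notin> P"
        using y by (auto simp: colon_def)
      have "x \<odot>\<^bsub>M\<^esub> (y \<odot>\<^bsub>M\<^esub> m) \<in> P"
        using a x y m by (auto simp: colon_def M.smult_assoc1)
      with P m x y show "x \<in> colon R M P"
        unfolding prime_submodule_def by (meson M.smult_closed)
    qed
  next
    assume "x \<in> colon R M P \<or> y \<in> colon R M P"
    then show "x \<otimes>\<^bsub>R\<^esub> y \<in> colon R M P"
    proof
      assume "x \<in> colon R M P"
      then show ?thesis
        using x y by (auto simp: colon_def M.smult_assoc1)
    next
      assume "y \<in> colon R M P"
      then show ?thesis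
        unfolding colon_def using x y by (auto simp: M.smult_assoc1)
    qed
  qed
qed

lemma one_notin_colon:
  assumes M: "Module.module R M" and P: "prime_submodule P R M"
  shows "\<one>\<^bsub>R\<^esub> \<notin> colon R M P"
proof
  interpret M: Module.module R M by (rule M)
  assume "\<one>\<^bsub>R\<^esub> \<in> colon R M P"
  then have "carrier M \<subseteq> P" by (auto simp: colon_def)
  moreover have "P \<subseteq> carrier M" "P \<noteq> carrier M"
    using P M.submoduleE(1) by (auto simp: prime_submodule_def)
  ultimately show False by blast
qed

lemma submonoid_set_mult:
  assumes M: "Module.module R M" and S: "submonoid S R" and T: "submonoid T R"
  shows "submonoid {s \<otimes>\<^bsub>R\<^esub> t | s t. s \<in> S \<and> t \<in> T} R"
proof
  interpret M: Module.module R M by (rule M)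
  interpret S: submonoid S R by (rule S)
  interpret T: submonoid T R by (rule T)
  show "{s \<otimes>\<^bsub>R\<^esub> t | s t. s \<in> S \<and> t \<in> T} \<subseteq> carrier R"
    by auto
  show "\<one>\<^bsub>R\<^esub> \<in> {s \<otimes>\<^bsub>R\<^esub> t | s t. s \<in> S \<and> t \<in> T}"
    using S.one_closed T.one_closed M.R.l_one[OF M.R.one_closed] by (smt (verit) mem_Collect_eq)
  fix x y
  assume "x \<in> {s \<otimes>\<^bsub>R\<^esub> t | s t. s \<in> S \<and> t \<in> T}" "y \<in> {s \<otimes>\<^bsub>R\<^esub> t | s t. s \<in> S \<and> t \<in> T}"
  then obtain s t s' t' where e: "x = s \<otimes>\<^bsub>R\<^esub> t" "y = s' \<otimes>\<^bsub>R\<^esub> t'"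
    and m: "s \<in> S" "t \<in> T" "s' \<in> S" "t' \<in> T" by blast
  have "x \<otimes>\<^bsub>R\<^esub> y = (s \<otimes>\<^bsub>R\<^esub> s') \<otimes>\<^bsub>R\<^esub> (t \<otimes>\<^bsub>R\<^esub> t')"
    unfolding e using m by (simp add: M.R.m_ac)
  then show "x \<otimes>\<^bsub>R\<^esub> y \<in> {s \<otimes>\<^bsub>R\<^esub> t | s t. s \<in> S \<and> t \<in> T}"
    using m by blast
qed

lemma istopology_Spec_tilde:
  assumes M: "Module.module R M"
  shows "istopology (\<lambda>U. U \<subseteq> mod_Spec R M \<and>
      (\<exists>\<S>. (\<forall>S \<in> \<S>. submonoid S R) \<and> mod_Spec R M - U = V_tilde R M \<S>))"
    (is "istopology ?L")
  unfolding istopology_def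
proof (intro conjI allI impI)
  fix U U' assume L: "?L U" "?L U'"
  then show "U \<inter> U' \<subseteq> mod_Spec R M" by blast
  from L obtain \<S> \<T> where \<S>: "\<forall>S \<in> \<S>. submonoid S R" "mod_Spec R M - U = V_tilde R M \<S>"
    and \<T>: "\<forall>T \<in> \<T>. submonoid T R" "mod_Spec R M - U' = V_tilde R M \<T>"
    by blast
  define \<W> where "\<W> = {{s \<otimes>\<^bsub>R\<^esub> t | s t. s \<in> S \<and> t \<in> T} | S T. S \<in> \<S> \<and> T \<in> \<T>}"
  have 1: "\<forall>W \<in> \<W>. submonoid W R"
    unfolding \<W>_def using \<S>(1) \<T>(1) submonoid_set_mult[OF M] by blast
  have meet: "colon R M P \<inter> {s \<otimes>\<^bsub>R\<^esub> t | s t. s \<in> S \<and> t \<in> T} \<noteq> {} \<longleftrightarrow>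
      colon R M P \<inter> S \<noteq> {} \<or> colon R M P \<inter> T \<noteq> {}"
    if "P \<in> mod_Spec R M" "S \<in> \<S>" "T \<in> \<T>" for P S T
  proof -
    have P: "prime_submodule P R M" using that by (simp add: mod_Spec_def)
    interpret S: submonoid S R using that \<S> by blast
    interpret T: submonoid T R using that \<T> by blast
    have "s \<otimes>\<^bsub>R\<^esub> t \<in> colon R M P \<longleftrightarrow> s \<in> colon R M P \<or> t \<in> colon R M P"
      if "s \<in> S" "t \<in> T" for s t
      using colon_mult_iff[OF M P] that by auto
    then show ?thesis
      using S.one_closed T.one_closed by blast
  qed
  have "V_tilde R M \<W> = V_tilde R M \<S> \<union> V_tilde R M \<T>"
  proof (rule Set.set_eqI)
    fix P
    have "P \<in> V_tilde R M \<W> \<longleftrightarrow> P \<in> mod_Spec R M \<and>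
       (\<forall>S\<in>\<S>. \<forall>T\<in>\<T>. colon R M P \<inter> {s \<otimes>\<^bsub>R\<^esub> t | s t. s \<in> S \<and> t \<in> T} \<noteq> {})"
      unfolding V_tilde_def \<W>_def by blast
    also have "\<dots> \<longleftrightarrow> P \<in> mod_Spec R M \<and>
       (\<forall>S\<in>\<S>. \<forall>T\<in>\<T>. colon R M P \<inter> S \<noteq> {} \<or> colon R M P \<inter> T \<noteq> {})"
      using meet by (metis (no_types, lifting))
    also have "\<dots> \<longleftrightarrow> P \<in> V_tilde R M \<S> \<union> V_tilde R M \<T>"
      unfolding V_tilde_def by blast
    finally show "P \<in> V_tilde R M \<W> \<longleftrightarrow> P \<in> V_tilde R M \<S> \<union> V_tilde R M \<T>" .
  qed
  then have "mod_Spec R M - U \<inter> U' = V_tilde R M \<W>"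
    using \<S>(2) \<T>(2) by blast
  with 1 show "\<exists>\<S>. (\<forall>S \<in> \<S>. submonoid S R) \<and> mod_Spec R M - U \<inter> U' = V_tilde R M \<S>"
    by blast
next
  fix \<K> assume L: "\<forall>K\<in>\<K>. ?L K"
  then show "\<Union>\<K> \<subseteq> mod_Spec R M" by blast
  from L obtain f where f: "\<And>K. K \<in> \<K> \<Longrightarrow> \<forall>S \<in> f K. submonoid S R"
    "\<And>K. K \<in> \<K> \<Longrightarrow> mod_Spec R M - K = V_tilde R M (f K)"
    by metis
  have "mod_Spec R M - \<Union>\<K> = mod_Spec R M \<inter> (\<Inter>K\<in>\<K>. mod_Spec R M - K)" by blast
  also have "\<dots> = mod_Spec R M \<inter> (\<Inter>K\<in>\<K>. V_tilde R M (f K))" using f(2) by simp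
  also have "\<dots> = V_tilde R M (\<Union>(f ` \<K>))"
    unfolding V_tilde_def by blast
  finally have "mod_Spec R M - \<Union>\<K> = V_tilde R M (\<Union>(f ` \<K>))" .
  moreover have "\<forall>S \<in> \<Union>(f ` \<K>). submonoid S R" using f(1) by blast
  ultimately show "\<exists>\<S>. (\<forall>S \<in> \<S>. submonoid S R) \<and> mod_Spec R M - \<Union>\<K> = V_tilde R M \<S>"
    by blast
qed

lemma topspace_Spec_tilde:
  assumes M: "Module.module R M"
  shows "topspace (Spec_tilde R M) = mod_Spec R M"
proof -
  interpret M: Module.module R M by (rule M)
  have "submonoid {\<one>\<^bsub>R\<^esub>} R" by (simp add: submonoid_def)
  moreover have "V_tilde R M {{\<one>\<^bsub>R\<^esub>}} = {}"
    using one_notin_colon[OF M] by (auto simp: V_tilde_def mod_Spec_def)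
  ultimately have "openin (Spec_tilde R M) (mod_Spec R M)"
    unfolding Spec_tilde_def topology_inverse'[OF istopology_Spec_tilde[OF M]]
    by (intro conjI exI[of _ "{{\<one>\<^bsub>R\<^esub>}}"]) auto
  moreover have "openin (Spec_tilde R M) U \<Longrightarrow> U \<subseteq> mod_Spec R M" for U
    unfolding Spec_tilde_def topology_inverse'[OF istopology_Spec_tilde[OF M]] by blast
  ultimately show ?thesis
    by (meson openin_subset openin_topspace subset_antisym)
qed

lemma closedin_Spec_tilde:
  assumes M: "Module.module R M"
  shows "closedin (Spec_tilde R M) C \<longleftrightarrow>
    (\<exists>\<S>. (\<forall>S \<in> \<S>. submonoid S R) \<and> C = V_tilde R M \<S>)"
proof -
  have V: "V_tilde R M \<S> \<subseteq> mod_Spec R M" for \<S>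
    by (auto simp: V_tilde_def)
  have "closedin (Spec_tilde R M) C \<longleftrightarrow>
    C \<subseteq> mod_Spec R M \<and> (\<exists>\<S>. (\<forall>S \<in> \<S>. submonoid S R) \<and> mod_Spec R M - (mod_Spec R M - C) = V_tilde R M \<S>)"
    unfolding closedin_def topspace_Spec_tilde[OF M]
    unfolding Spec_tilde_def topology_inverse'[OF istopology_Spec_tilde[OF M]] by blast
  then show ?thesis
    using V by (metis double_diff order_refl)
qed

end

theory Submission
  imports Defs
begin

text \<open>A prime submodule \<open>P\<close> fails to lie in \<open>V_tilde R M \<S>\<close>
  exactly when its colon ideal misses some member of \<open>\<S>\<close>, that is, when
  \<open>P\<close> lies in some \<open>D_tilde R M S\<close>. By this De Morgan identity
  (\<open>Diff_V_tilde\<close>), the open sets are precisely the unions of sets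
  \<open>D_tilde R M S\<close> (\<open>openin_Spec_tilde\<close>), which is what being a basis
  means.\<close>

lemma Diff_V_tilde: "mod_Spec R M - V_tilde R M \<S> = (\<Union>S\<in>\<S>. D_tilde R M S)"
  unfolding V_tilde_def D_tilde_def by blast

text \<open>Complements the description of closed sets in \<open>closedin_Spec_tilde\<close>. Both
  halves of the basis property are read off from this equivalence, one from each direction.\<close>

lemma openin_Spec_tilde:
  assumes M: "Module.module R M"
  shows "openin (Spec_tilde R M) U \<longleftrightarrow>
    (\<exists>\<S>. (\<forall>S \<in> \<S>. submonoid S R) \<and> U = (\<Union>S\<in>\<S>. D_tilde R M S))"
proof
  assume U: "openin (Spec_tilde R M) U"
  then have "closedin (Spec_tilde R M) (mod_Spec R M - U)"
    using closedin_diff[OF closedin_topspace U] by (simp add: topspace_Spec_tilde[OF M])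
  then obtain \<S> where \<S>: "\<forall>S \<in> \<S>. submonoid S R" "mod_Spec R M - U = V_tilde R M \<S>"
    unfolding closedin_Spec_tilde[OF M] by blast
  \<comment> \<open>Ensures that taking the complement twice inside \<open>mod_Spec R M\<close>
    gives back \<open>U\<close>.\<close>
  have "U \<subseteq> mod_Spec R M"
    using openin_subset[OF U] by (simp add: topspace_Spec_tilde[OF M])
  then have "U = (\<Union>S\<in>\<S>. D_tilde R M S)"
    unfolding Diff_V_tilde[symmetric] \<S>(2)[symmetric] by blast
  with \<S>(1) show "\<exists>\<S>. (\<forall>S \<in> \<S>. submonoid S R) \<and> U = (\<Union>S\<in>\<S>. D_tilde R M S)"
    by blast
next
  assume "\<exists>\<S>. (\<forall>S \<in> \<S>. submonoid S R) \<and> U = (\<Union>S\<in>\<S>. D_tilde R M S)"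
  then obtain \<S> where \<S>: "\<forall>S \<in> \<S>. submonoid S R" "U = mod_Spec R M - V_tilde R M \<S>"
    unfolding Diff_V_tilde by blast
  then have "closedin (Spec_tilde R M) (V_tilde R M \<S>)"
    unfolding closedin_Spec_tilde[OF M] by blast
  from openin_diff[OF openin_topspace this] show "openin (Spec_tilde R M) U"
    by (simp add: topspace_Spec_tilde[OF M] \<S>(2))
qed

theorem theorem2:
  fixes R :: "('r, 'a) ring_scheme" and M :: "('r, 'm, 'b) module_scheme"
  assumes "Module.module R M"
    and "mod_Spec R M \<noteq> {}"
  shows "basis_of (Spec_tilde R M) {D_tilde R M S | S. submonoid S R}"
  unfolding basis_of_def
proof (intro conjI ballI allI impI)
  fix B assume "B \<in> {D_tilde R M S | S. submonoid S R}"
  then obtain S where "submonoid S R" "B = D_tilde R M S" by blast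
  \<comment> \<open>A single basic set is the union over a one-member family.\<close>
  then show "openin (Spec_tilde R M) B"
    unfolding openin_Spec_tilde[OF assms(1)] by (intro exI[of _ "{S}"]) simp
next
  fix U assume "openin (Spec_tilde R M) U"
  then obtain \<S> where "\<forall>S \<in> \<S>. submonoid S R" "U = (\<Union>S\<in>\<S>. D_tilde R M S)"
    unfolding openin_Spec_tilde[OF assms(1)] by blast
  \<comment> \<open>The family defining \<open>U\<close> is turned into a set of basic sets; an
    empty family gives the empty open set.\<close>
  then show "\<exists>\<B>'. \<B>' \<subseteq> {D_tilde R M S | S. submonoid S R} \<and> \<Union>\<B>' = U"
    by (intro exI[of _ "D_tilde R M ` \<S>"]) blast
qed

end
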